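(* The $k$-assignment polytope $M_{m,n,k}$ fulfills the rhombus criterion.
   Context: The $k$-assignment polytope $M_{m,n,k}$ is the convex hull of all $0/1$-matrices of size $m\times n$ having exactly $k$ entries equal to $1$ and such that no row and no column contains more than one $1$. A polytope $P$ with vertex set $V$ fulfills the rhombus criterion if for every pair of distinct vertices $\alpha,\beta\in V$, either $\operatorname{conv}(\alpha,\beta)$ is an edge (1-dimensional face) of $P$, or there exist $\alpha',\beta'\in V\setminus\{\alpha,\beta\}$ with $\alpha+\beta=\alpha'+\beta'$. *)

theory Defs
  imports "HOL-Analysis.Analysis"
begin

definition k_assignment_matrices :: "nat \<Rightarrow> (real ^ 'n ^ 'm) set" where
  "k_assignment_matrices k =
     {A. (\<forall>i j. A $ i $ j = 0 \<or> A $ i $ j = 1) \<and>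
         card {(i, j). A $ i $ j = 1} = k \<and>
         (\<forall>i. card {j. A $ i $ j = 1} \<le> 1) \<and>
         (\<forall>j. card {i. A $ i $ j = 1} \<le> 1)}"

text \<open>The numbers of rows and columns are \<open>m = CARD('m)\<close> and \<open>n = CARD('n)\<close>.
  For \<open>k > min m n\<close> the polytope is empty.\<close>

definition k_assignment_polytope :: "nat \<Rightarrow> (real ^ 'n ^ 'm) set" where
  "k_assignment_polytope k = convex hull (k_assignment_matrices k)"

definition polytope_vertices :: "'a::euclidean_space set \<Rightarrow> 'a set" where
  "polytope_vertices P = {v. v extreme_point_of P}"

definition rhombus_criterion :: "'a::euclidean_space set \<Rightarrow> bool" where
  "rhombus_criterion P \<longleftrightarrow>
     polytope P \<and>
     (\<forall>\<alpha> \<in> polytope_vertices P. \<forall>\<beta> \<in> polytope_vertices P. \<alpha> \<noteq> \<beta> \<longrightarrow>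
        (convex hull {\<alpha>, \<beta>}) edge_of P \<or>
        (\<exists>\<alpha>' \<in> polytope_vertices P - {\<alpha>, \<beta>}.
         \<exists>\<beta>' \<in> polytope_vertices P - {\<alpha>, \<beta>}. \<alpha> + \<beta> = \<alpha>' + \<beta>'))"

end

theory Submission
  imports Defs
begin

text \<open>Let \<open>\<alpha> \<noteq> \<beta>\<close> be vertices. If the line through them meets the convex hull of the other
  vertices in a point \<open>p\<close>, some vertex \<open>v\<close> occurs with positive weight in \<open>p\<close>, so \<open>v\<close> attains
  every valid inequality that \<open>p\<close> attains: \<open>v\<close> vanishes outside the supports of \<open>\<alpha>\<close> and \<open>\<beta>\<close>,
  contains their common ones, and covers every row and column covered by both. Hence
  \<open>\<alpha> + \<beta> - v\<close> is again a \<open>k\<close>-assignment matrix, which completes the rhombus. If there is no such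
  point \<open>p\<close>, then \<open>\<alpha>\<close> and \<open>\<beta>\<close> span an edge.\<close>

text \<open>Any \<open>x\<close> with nonzero weight in a convex combination giving \<open>p\<close>
  works: if \<open>f p = c\<close>, the weighted slacks \<open>c - f y\<close> are nonnegative and
  sum to zero, so the slack at \<open>x\<close> vanishes. The choice of \<open>x\<close> precedes
  \<open>f\<close> and \<open>c\<close>, so a single point serves all tight inequalities at
  once.\<close>

lemma convex_hull_tight_point:
  fixes S :: "'a::real_vector set"
  assumes "finite S" "p \<in> convex hull S"
  obtains x where "x \<in> S"
    and "\<And>f c. \<lbrakk>linear f; \<And>y. y \<in> S \<Longrightarrow> f y \<le> c; f p = c\<rbrakk> \<Longrightarrow> f x = (c::real)"
    and "\<And>f c. \<lbrakk>linear f; \<And>y. y \<in> S \<Longrightarrow> c \<le> f y; f p = c\<rbrakk> \<Longrightarrow> f x = (c::real)"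
proof -
  obtain u where u: "\<forall>x\<in>S. 0 \<le> u x" "sum u S = 1" "(\<Sum>x\<in>S. u x *\<^sub>R x) = p"
    using assms by (auto simp: convex_hull_finite)
  obtain x where x: "x \<in> S" "u x \<noteq> 0"
    using u(2) by (metis sum.neutral zero_neq_one)
  have tight: "f x = c" if f: "linear f" "\<And>y. y \<in> S \<Longrightarrow> f y \<le> c" "f p = c" for f and c :: real
  proof -
    have "f p = (\<Sum>y\<in>S. u y * f y)"
      unfolding u(3)[symmetric] using f(1) by (simp add: linear_sum linear_scale)
    then have "(\<Sum>y\<in>S. u y * (c - f y)) = 0"
      using f(3) u(2) by (simp add: right_diff_distrib sum_subtractf flip: sum_distrib_right)
    moreover have "0 \<le> u y * (c - f y)" if "y \<in> S" for y
      using u(1) f(2) that by auto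
    ultimately have "u x * (c - f x) = 0"
      using assms(1) x(1) by (simp add: sum_nonneg_eq_0_iff)
    then show ?thesis using x(2) by simp
  qed
  moreover have "f x = c" if f: "linear f" "\<And>y. y \<in> S \<Longrightarrow> c \<le> f y" "f p = c" for f and c :: real
    using tight[of "\<lambda>y. - f y" "- c"] f by (simp add: linear_compose_neg)
  ultimately show thesis using that x(1) by blast
qed

lemma zero_one_sum_eq_card:
  fixes f :: "'a::finite \<Rightarrow> real"
  assumes "\<And>x. f x = 0 \<or> f x = 1"
  shows "sum f UNIV = real (card {x. f x = 1})"
proof -
  have "sum f UNIV = (\<Sum>x\<in>UNIV. if f x = 1 then 1 else 0)"
    by (rule sum.cong) (use assms in auto)
  also have "\<dots> = real (card {x. f x = 1})"
    by (simp add: sum.If_cases)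
  finally show ?thesis .
qed

text \<open>The sum counts ones and is therefore an integer. This splits rows and columns into
  covered and uncovered ones.\<close>

lemma zero_one_sum_le_1_cases:
  fixes f :: "'a::finite \<Rightarrow> real"
  assumes "\<And>x. f x = 0 \<or> f x = 1" "sum f UNIV \<le> 1"
  shows "sum f UNIV = 0 \<or> sum f UNIV = 1"
  proof -
  have "sum f UNIV = real (card {x. f x = 1})"
    by (rule zero_one_sum_eq_card) (rule assms(1))
  then show ?thesis using assms(2) by (simp add: le_Suc_eq)
qed

text \<open>Trading cardinalities for sums turns the constraints into linear functionals, to which
  \<open>convex_hull_tight_point\<close> applies.\<close>

lemma k_assignment_matrices_iff_sums:
  fixes A :: "real ^ 'n ^ 'm"
  shows "A \<in> k_assignment_matrices k \<longleftrightarrow>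
    (\<forall>i j. A $ i $ j = 0 \<or> A $ i $ j = 1) \<and>
    (\<Sum>i\<in>UNIV. \<Sum>j\<in>UNIV. A $ i $ j) = real k \<and>
    (\<forall>i. (\<Sum>j\<in>UNIV. A $ i $ j) \<le> 1) \<and>
    (\<forall>j. (\<Sum>i\<in>UNIV. A $ i $ j) \<le> 1)"
proof (cases "\<forall>i j. A $ i $ j = 0 \<or> A $ i $ j = 1")
  case True
  have "(\<Sum>i\<in>UNIV. \<Sum>j\<in>UNIV. A $ i $ j) = (\<Sum>(i, j)\<in>UNIV. A $ i $ j)"
    by (simp add: sum.cartesian_product)
  also have "\<dots> = real (card {(i, j). A $ i $ j = 1})"
    using zero_one_sum_eq_card[of "\<lambda>(i, j). A $ i $ j"] True by (simp add: case_prod_unfold)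
  finally show ?thesis
    using True by (simp add: k_assignment_matrices_def zero_one_sum_eq_card)
qed (auto simp: k_assignment_matrices_def)

lemma finite_k_assignment_matrices:
  "finite (k_assignment_matrices k :: (real ^ 'n ^ 'm) set)"
proof (rule finite_subset)
  \<comment> \<open>A 0/1 matrix is determined by its support \<open>E\<close>, and there are
    finitely many supports.\<close>
  let ?M = "\<lambda>E. (\<chi> i j. if (i, j) \<in> E then 1 else 0) :: real ^ 'n ^ 'm"
  show "(k_assignment_matrices k :: (real ^ 'n ^ 'm) set) \<subseteq> range ?M"
  proof
    fix A :: "real ^ 'n ^ 'm"
    assume "A \<in> k_assignment_matrices k"
    then have "A = ?M {(i, j). A $ i $ j = 1}"
      by (auto simp: k_assignment_matrices_def vec_eq_iff)
    then show "A \<in> range ?M" by blast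
  qed
qed simp

lemma linear_entry: "linear (\<lambda>A :: real ^ 'n ^ 'm. A $ i $ j)"
  by (rule linearI) simp_all

lemma linear_row_sum: "linear (\<lambda>A :: real ^ 'n ^ 'm. \<Sum>j\<in>UNIV. A $ i $ j)"
  by (intro linear_compose_sum ballI linear_entry)

lemma linear_column_sum: "linear (\<lambda>A :: real ^ 'n ^ 'm. \<Sum>i\<in>UNIV. A $ i $ j)"
  by (intro linear_compose_sum ballI linear_entry)

lemma polytope_vertices_k_assignment_polytope:
  "polytope_vertices (k_assignment_polytope k) = (k_assignment_matrices k :: (real ^ 'n ^ 'm) set)"
proof (intro equalityI subsetI)
  fix A :: "real ^ 'n ^ 'm"
  assume "A \<in> polytope_vertices (k_assignment_polytope k)"
  then show "A \<in> k_assignment_matrices k"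
    using extreme_point_of_convex_hull
    by (auto simp: polytope_vertices_def k_assignment_polytope_def)
next
  fix A :: "real ^ 'n ^ 'm"
  let ?V = "k_assignment_matrices k :: (real ^ 'n ^ 'm) set"
  assume A: "A \<in> ?V"
  have "A \<notin> convex hull (?V - {A})"
  proof
    assume "A \<in> convex hull (?V - {A})"
    then obtain B where B: "B \<in> ?V - {A}"
      and le: "\<And>f c. \<lbrakk>linear f; \<And>y. y \<in> ?V - {A} \<Longrightarrow> f y \<le> c; f A = c\<rbrakk> \<Longrightarrow> f B = (c::real)"
      and ge: "\<And>f c. \<lbrakk>linear f; \<And>y. y \<in> ?V - {A} \<Longrightarrow> c \<le> f y; f A = c\<rbrakk> \<Longrightarrow> f B = (c::real)"
      using convex_hull_tight_point[of "?V - {A}"] finite_k_assignment_matrices by blast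
    have bnd: "0 \<le> M $ i $ j" "M $ i $ j \<le> 1" if "M \<in> ?V - {A}" for M i j
      using that by (auto simp: k_assignment_matrices_def) (metis zero_le_one order_refl)+
    have "B $ i $ j = A $ i $ j" for i j
    proof -
      have "A $ i $ j = 0 \<or> A $ i $ j = 1"
        using A by (auto simp: k_assignment_matrices_def)
      then show ?thesis
        \<comment> \<open>The value 0 or 1 of an entry of \<open>A\<close> is an extreme value of
          that coordinate, so \<open>B\<close> is forced to agree with \<open>A\<close>
          there.\<close>
        using le[OF linear_entry, of i j 1] ge[OF linear_entry, of 0 i j] bnd by metis
    qed
    then show False using B by (simp add: vec_eq_iff)
  qed
  \<comment> \<open>The affine hull of \<open>{A}\<close> is \<open>{A}\<close> itself, so avoiding
    the hull of the other matrices makes it a face.\<close>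
  then have "convex hull {A} face_of convex hull ?V"
    using A finite_k_assignment_matrices by (intro face_of_convex_hulls) auto
  then show "A \<in> polytope_vertices (k_assignment_polytope k)"
    by (simp add: polytope_vertices_def k_assignment_polytope_def face_of_singleton)
qed

text \<open>An entry of \<alpha> + \<beta> is 0, 1 or 2. Subtracting \<open>v\<close> could leave
  the range only at 0 or 2, where \<open>zero\<close> and \<open>one\<close> fix the entry of
  \<open>v\<close>. A row or column sum could exceed 1 only where both sums are 1, and there
  \<open>v\<close> removes 1. The total is k + k - k.\<close>

lemma k_assignment_rhombus_complement:
  fixes \<alpha> \<beta> v :: "real ^ 'n ^ 'm"
  assumes \<alpha>: "\<alpha> \<in> k_assignment_matrices k" and \<beta>: "\<beta> \<in> k_assignment_matrices k"
    and v: "v \<in> k_assignment_matrices k"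
    and zero: "\<And>i j. \<lbrakk>\<alpha> $ i $ j = 0; \<beta> $ i $ j = 0\<rbrakk> \<Longrightarrow> v $ i $ j = 0"
    and one: "\<And>i j. \<lbrakk>\<alpha> $ i $ j = 1; \<beta> $ i $ j = 1\<rbrakk> \<Longrightarrow> v $ i $ j = 1"
    and row: "\<And>i. \<lbrakk>(\<Sum>j\<in>UNIV. \<alpha> $ i $ j) = 1; (\<Sum>j\<in>UNIV. \<beta> $ i $ j) = 1\<rbrakk>
      \<Longrightarrow> (\<Sum>j\<in>UNIV. v $ i $ j) = 1"
    and col: "\<And>j. \<lbrakk>(\<Sum>i\<in>UNIV. \<alpha> $ i $ j) = 1; (\<Sum>i\<in>UNIV. \<beta> $ i $ j) = 1\<rbrakk>
      \<Longrightarrow> (\<Sum>i\<in>UNIV. v $ i $ j) = 1"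
  shows "\<alpha> + \<beta> - v \<in> k_assignment_matrices k"
proof -
  note sums = \<alpha>[unfolded k_assignment_matrices_iff_sums] \<beta>[unfolded k_assignment_matrices_iff_sums]
    v[unfolded k_assignment_matrices_iff_sums]
  have "(\<alpha> + \<beta> - v) $ i $ j = 0 \<or> (\<alpha> + \<beta> - v) $ i $ j = 1" for i j
  proof -
    have "\<alpha> $ i $ j = 0 \<or> \<alpha> $ i $ j = 1" "\<beta> $ i $ j = 0 \<or> \<beta> $ i $ j = 1"
      "v $ i $ j = 0 \<or> v $ i $ j = 1"
      using sums by blast+
    then show ?thesis using zero[of i j] one[of i j] by auto
  qed
  moreover have "(\<Sum>i\<in>UNIV. \<Sum>j\<in>UNIV. (\<alpha> + \<beta> - v) $ i $ j) = real k"
    using sums by (simp add: sum.distrib sum_subtractf)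
  moreover have "(\<Sum>j\<in>UNIV. (\<alpha> + \<beta> - v) $ i $ j) \<le> 1" for i
  proof -
    have "(\<Sum>j\<in>UNIV. \<alpha> $ i $ j) = 0 \<or> (\<Sum>j\<in>UNIV. \<alpha> $ i $ j) = 1"
      "(\<Sum>j\<in>UNIV. \<beta> $ i $ j) = 0 \<or> (\<Sum>j\<in>UNIV. \<beta> $ i $ j) = 1"
      "(\<Sum>j\<in>UNIV. v $ i $ j) = 0 \<or> (\<Sum>j\<in>UNIV. v $ i $ j) = 1"
      by (rule zero_one_sum_le_1_cases; use sums in blast)+
    then show ?thesis using row[of i] by (auto simp: sum.distrib sum_subtractf)
  qed
  moreover have "(\<Sum>i\<in>UNIV. (\<alpha> + \<beta> - v) $ i $ j) \<le> 1" for j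
  proof -
    have "(\<Sum>i\<in>UNIV. \<alpha> $ i $ j) = 0 \<or> (\<Sum>i\<in>UNIV. \<alpha> $ i $ j) = 1"
      "(\<Sum>i\<in>UNIV. \<beta> $ i $ j) = 0 \<or> (\<Sum>i\<in>UNIV. \<beta> $ i $ j) = 1"
      "(\<Sum>i\<in>UNIV. v $ i $ j) = 0 \<or> (\<Sum>i\<in>UNIV. v $ i $ j) = 1"
      by (rule zero_one_sum_le_1_cases; use sums in blast)+
    then show ?thesis using col[of j] by (auto simp: sum.distrib sum_subtractf)
  qed
  ultimately show ?thesis by (simp only: k_assignment_matrices_iff_sums) blast
qed

lemma k_assignment_edge_or_rhombus:
  fixes \<alpha> \<beta> :: "real ^ 'n ^ 'm"
  assumes \<alpha>: "\<alpha> \<in> k_assignment_matrices k" and \<beta>: "\<beta> \<in> k_assignment_matrices k"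
    and "\<alpha> \<noteq> \<beta>"
  shows "(convex hull {\<alpha>, \<beta>}) edge_of k_assignment_polytope k \<or>
    (\<exists>v \<in> k_assignment_matrices k - {\<alpha>, \<beta>}.
     \<exists>w \<in> k_assignment_matrices k - {\<alpha>, \<beta>}. \<alpha> + \<beta> = v + w)"
\<comment> \<open>The whole line, not just the segment, is tested because
  \<open>face_of_convex_hulls\<close> requires the affine hull to miss the hull of the remaining
  points.\<close>
proof (cases "affine hull {\<alpha>, \<beta>} \<inter> convex hull (k_assignment_matrices k - {\<alpha>, \<beta>}) = {}")
  case True
  then have "convex hull {\<alpha>, \<beta>} face_of k_assignment_polytope k"
    unfolding k_assignment_polytope_def using \<alpha> \<beta> finite_k_assignment_matrices
    by (intro face_of_convex_hulls) auto
  then show ?thesis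
    using \<open>\<alpha> \<noteq> \<beta>\<close> by (simp add: edge_of_def aff_dim_convex_hull aff_dim_2)
next
  case False
  let ?V = "k_assignment_matrices k :: (real ^ 'n ^ 'm) set"
  let ?S = "?V - {\<alpha>, \<beta>}"
  obtain p where p: "p \<in> affine hull {\<alpha>, \<beta>}" "p \<in> convex hull ?S"
    using False by blast
  obtain t where t: "p = \<alpha> + t *\<^sub>R (\<beta> - \<alpha>)"
    using p(1) by (auto simp: affine_hull_2_alt)
  obtain v where v: "v \<in> ?S"
    and le: "\<And>f c. \<lbrakk>linear f; \<And>y. y \<in> ?S \<Longrightarrow> f y \<le> c; f p = c\<rbrakk> \<Longrightarrow> f v = (c::real)"
    and ge: "\<And>f c. \<lbrakk>linear f; \<And>y. y \<in> ?S \<Longrightarrow> c \<le> f y; f p = c\<rbrakk> \<Longrightarrow> f v = (c::real)"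
    using convex_hull_tight_point[OF _ p(2)] finite_k_assignment_matrices by blast
  \<comment> \<open>A linear functional with equal values at \<alpha> and \<beta> is constant on
    their line, so \<open>p\<close> need not lie between them and the sign and size of
    \<open>t\<close> do not matter.\<close>
  have line: "f p = c" if "linear f" "f \<alpha> = c" "f \<beta> = c" for f and c :: real
    using that by (simp add: t linear_add linear_diff linear_scale)
  have bnd: "0 \<le> M $ i $ j" "M $ i $ j \<le> 1" "(\<Sum>j\<in>UNIV. M $ i $ j) \<le> 1"
    "(\<Sum>i\<in>UNIV. M $ i $ j) \<le> 1" if "M \<in> ?S" for M i j
  proof -
    have "M $ i $ j = 0 \<or> M $ i $ j = 1" "(\<Sum>j\<in>UNIV. M $ i $ j) \<le> 1"
      "(\<Sum>i\<in>UNIV. M $ i $ j) \<le> 1"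
      using that by (simp_all add: k_assignment_matrices_iff_sums)
    then show "0 \<le> M $ i $ j" "M $ i $ j \<le> 1" "(\<Sum>j\<in>UNIV. M $ i $ j) \<le> 1"
      "(\<Sum>i\<in>UNIV. M $ i $ j) \<le> 1" by auto
  qed
  have "\<alpha> + \<beta> - v \<in> ?V"
  proof (rule k_assignment_rhombus_complement[OF \<alpha> \<beta>])
    show "v \<in> ?V" using v by blast
  next
    fix i j assume "\<alpha> $ i $ j = 0" "\<beta> $ i $ j = 0"
    then show "v $ i $ j = 0" by (intro ge[OF linear_entry] bnd line[OF linear_entry])
  next
    fix i j assume "\<alpha> $ i $ j = 1" "\<beta> $ i $ j = 1"
    then show "v $ i $ j = 1" by (intro le[OF linear_entry] bnd line[OF linear_entry])
  next
    fix i assume "(\<Sum>j\<in>UNIV. \<alpha> $ i $ j) = 1" "(\<Sum>j\<in>UNIV. \<beta> $ i $ j) = 1"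
    then show "(\<Sum>j\<in>UNIV. v $ i $ j) = 1"
      by (intro le[OF linear_row_sum] bnd line[OF linear_row_sum])
  next
    fix j assume "(\<Sum>i\<in>UNIV. \<alpha> $ i $ j) = 1" "(\<Sum>i\<in>UNIV. \<beta> $ i $ j) = 1"
    then show "(\<Sum>i\<in>UNIV. v $ i $ j) = 1"
      by (intro le[OF linear_column_sum] bnd line[OF linear_column_sum])
  qed
  \<comment> \<open>If the complement of \<open>v\<close> were \<alpha> or \<beta>, then
    \<open>v\<close> would be the other of the two.\<close>
  then have "\<alpha> + \<beta> - v \<in> ?S" using v by (auto simp: algebra_simps)
  moreover have "\<alpha> + \<beta> = v + (\<alpha> + \<beta> - v)" by simp
  ultimately show ?thesis using v by blast
qed

theorem proposition4p4:
  fixes k :: nat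
  shows "rhombus_criterion (k_assignment_polytope k :: (real ^ 'n ^ 'm) set)"
proof -
  have "polytope (k_assignment_polytope k :: (real ^ 'n ^ 'm) set)"
    unfolding polytope_def k_assignment_polytope_def using finite_k_assignment_matrices by blast
  then show ?thesis
    \<comment> \<open>Since the vertices are exactly the \<open>k\<close>-assignment matrices, the
      dichotomy for pairs of matrices is the criterion itself.\<close>
    unfolding rhombus_criterion_def polytope_vertices_k_assignment_polytope
    using k_assignment_edge_or_rhombus by blast
qed

end
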